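(* Let $G$ be a finite group of order $n\ge 2$ with identity $e$, let $S\subseteq G\setminus\{e\}$ and let $T=(G\setminus\{e\})\setminus S$, so that $G\setminus\{e\}=S\cup T$. Then there exists a $k$ such that $S$ is a signature set for an $(n,k)$-equiangular frame if and only if the following hold: (a) $g\in S$ implies $g^{-1}\in S$, and $h\in T$ implies $h^{-1}\in T$; (b) there exists a real number $\mu$ such that for all $g\in S$, $$N_{(S,S)}^g-2N_{(S,T)}^g+N_{(T,T)}^g=\mu,$$ and for all $h\in T$, $$N_{(S,S)}^h-2N_{(S,T)}^h+N_{(T,T)}^h=-\mu.$$ In this case $k$ and $\mu$ are related by $$\mu=(n-2k)\sqrt{\frac{n-1}{k(n-k)}},\qquad k=\frac n2-\frac{\mu n}{2\sqrt{4(n-1)+\mu^2}}.$$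
   Context: For subsets $A,B\subseteq G$ and $g\in G$, $N_{(A,B)}^g=\#\{(g_1,g_2)\in A\times B: g_1g_2=g\}$. An $(n,k)$-frame is a Parseval frame $\{f_1,\dots,f_n\}$ for $\mathbb C^k$, i.e. $\sum_{j}|\langle x,f_j\rangle|^2=\|x\|^2$ for all $x\in\mathbb C^k$. It is equiangular if all $f_i\neq 0$ and there is a constant $b$ with $|\langle f_i/\|f_i\|,f_j/\|f_j\|\rangle|=b$ for all $i\ne j$. For $1\le k<n$, put $c_{n,k}=\sqrt{\frac{k(n-k)}{n^2(n-1)}}$. A self-adjoint $n\times n$ matrix $Q$ with $Q_{ii}=0$ and $|Q_{ij}|=1$ for $i\neq j$ is the signature matrix of an $(n,k)$-equiangular frame if there is an equiangular $(n,k)$-frame whose Gram matrix $(\langle f_j,f_i\rangle)_{i,j}$ equals $\frac kn I_n+c_{n,k}Q$. Throughout $1\le k<n$. Let $\lambda$ be the left regular representation of $G$: $\lambda(g)e_h=e_{gh}$ on the vector space with basis $\{e_h\}_{h\in G}$, regarded as $n\times n$ permutation matrices. For $S\subseteq G\setminus\{e\}$ and $T=(G\setminus\{e\})\setminus S$, the set $S$ is a signature set for an $(n,k)$-equiangular frame if $Q=\sum_{g\in S}\lambda(g)-\sum_{h\in T}\lambda(h)$ is the signature matrix of an $(n,k)$-equiangular frame. *)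

theory Defs
  imports "Jordan_Normal_Form.Schur_Decomposition" "HOL-Algebra.Coset"
begin

definition cvec_norm :: "complex vec \<Rightarrow> real" where
  "cvec_norm x = sqrt (Re (x \<bullet>c x))"

text \<open>
  A family of \<open>n\<close> vectors is a function on \<open>{..<n}\<close>, so indices start at \<open>0\<close>, as for matrices.
  The inner product \<open>x \<bullet>c y\<close> is linear in \<open>x\<close> and conjugate linear in \<open>y\<close>.
\<close>

definition parseval_frame :: "nat \<Rightarrow> nat \<Rightarrow> (nat \<Rightarrow> complex vec) \<Rightarrow> bool" where
  "parseval_frame n k f \<longleftrightarrow>
     (\<forall>j<n. f j \<in> carrier_vec k) \<and>
     (\<forall>x\<in>carrier_vec k. (\<Sum>j<n. (cmod (x \<bullet>c f j))\<^sup>2) = (cvec_norm x)\<^sup>2)"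

definition cvec_normalize :: "complex vec \<Rightarrow> complex vec" where
  "cvec_normalize x = complex_of_real (1 / cvec_norm x) \<cdot>\<^sub>v x"

definition equiangular_frame :: "nat \<Rightarrow> nat \<Rightarrow> (nat \<Rightarrow> complex vec) \<Rightarrow> bool" where
  "equiangular_frame n k f \<longleftrightarrow>
     parseval_frame n k f \<and>
     (\<forall>i<n. f i \<noteq> 0\<^sub>v k) \<and>
     (\<exists>b. \<forall>i<n. \<forall>j<n. i \<noteq> j \<longrightarrow>
        cmod (cvec_normalize (f i) \<bullet>c cvec_normalize (f j)) = b)"

definition gram_matrix :: "nat \<Rightarrow> (nat \<Rightarrow> complex vec) \<Rightarrow> complex mat" where
  "gram_matrix n f = mat n n (\<lambda>(i, j). f j \<bullet>c f i)"

definition frame_const :: "nat \<Rightarrow> nat \<Rightarrow> real" where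
  "frame_const n k =
     sqrt (real k * (real n - real k) / ((real n)\<^sup>2 * (real n - 1)))"

definition signature_matrix :: "nat \<Rightarrow> nat \<Rightarrow> complex mat \<Rightarrow> bool" where
  "signature_matrix n k Q \<longleftrightarrow>
     1 \<le> k \<and> k < n \<and>
     Q \<in> carrier_mat n n \<and> mat_adjoint Q = Q \<and>
     (\<forall>i<n. Q $$ (i, i) = 0) \<and>
     (\<forall>i<n. \<forall>j<n. i \<noteq> j \<longrightarrow> cmod (Q $$ (i, j)) = 1) \<and>
     (\<exists>f. equiangular_frame n k f \<and>
        gram_matrix n f =
          complex_of_real (real k / real n) \<cdot>\<^sub>m 1\<^sub>m n
          + complex_of_real (frame_const n k) \<cdot>\<^sub>m Q)"

text \<open>
  A bijection \<open>en\<close> from \<open>{..<n}\<close> to the group lists the basis \<open>(e\<^sub>h)\<close>, with \<open>h\<close> in the group, which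
  is what turns operators on its span into \<open>n \<times> n\<close> matrices. Column \<open>j\<close> of
  \<open>left_regular G n en g\<close> is the coordinate vector of \<open>e\<^bsub>gh\<^esub>\<close> for \<open>h = en j\<close>.
\<close>

definition left_regular ::
    "('a, 'b) monoid_scheme \<Rightarrow> nat \<Rightarrow> (nat \<Rightarrow> 'a) \<Rightarrow> 'a \<Rightarrow> complex mat" where
  "left_regular G n en g =
     mat n n (\<lambda>(i, j). if en i = g \<otimes>\<^bsub>G\<^esub> en j then 1 else 0)"

text \<open>Matrices of a fixed size are not a type, so their sums are taken in \<open>module_mat\<close>.\<close>

definition signature_set ::
    "('a, 'b) monoid_scheme \<Rightarrow> (nat \<Rightarrow> 'a) \<Rightarrow> nat \<Rightarrow> nat \<Rightarrow> 'a set \<Rightarrow> bool" where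
  "signature_set G en n k S \<longleftrightarrow>
     S \<subseteq> carrier G - {\<one>\<^bsub>G\<^esub>} \<and>
     signature_matrix n k
       (finsum (module_mat TYPE(complex) n n) (left_regular G n en) S
        - finsum (module_mat TYPE(complex) n n) (left_regular G n en)
            (carrier G - {\<one>\<^bsub>G\<^esub>} - S))"

definition num_prod ::
    "('a, 'b) monoid_scheme \<Rightarrow> 'a set \<Rightarrow> 'a set \<Rightarrow> 'a \<Rightarrow> nat" where
  "num_prod G A B g = card {(x, y) \<in> A \<times> B. x \<otimes>\<^bsub>G\<^esub> y = g}"

definition balanced_products ::
    "('a, 'b) monoid_scheme \<Rightarrow> 'a set \<Rightarrow> 'a set \<Rightarrow> real \<Rightarrow> bool" where
  "balanced_products G S T \<mu> \<longleftrightarrow>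
     (\<forall>g\<in>S. real (num_prod G S S g) - 2 * real (num_prod G S T g)
              + real (num_prod G T T g) = \<mu>) \<and>
     (\<forall>h\<in>T. real (num_prod G S S h) - 2 * real (num_prod G S T h)
              + real (num_prod G T T h) = - \<mu>)"

end

theory Submission
  imports Defs
begin

text \<open>
  Both sides of the equivalence say that \<open>Q = \<Sum>g\<in>S. \<lambda>(g) - \<Sum>h\<in>T. \<lambda>(h)\<close> is self-adjoint and satisfies
  a quadratic equation \<open>Q\<^sup>2 = (n - 1) I + \<mu> Q\<close>.

  For frames this comes from projections. The Gram matrix of a Parseval frame is idempotent
  (\<open>gram_matrix_idempotent\<close>), and conversely every Hermitian idempotent is the Gram matrix of a
  Parseval frame for a space whose dimension is its trace (\<open>idempotent_is_gram_of_parseval_frame\<close>).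
  If the Gram matrix has the form \<open>a I + c Q\<close> with \<open>c \<noteq> 0\<close>, then idempotence is a quadratic equation
  for \<open>Q\<close>; off the diagonal it reads \<open>Q\<^sup>2 = \<mu> Q\<close> with \<open>c \<mu> = 1 - 2 a\<close>. For \<open>a = k / n\<close> and
  \<open>c = frame_const n k\<close> this determines \<open>\<mu>\<close> from \<open>n\<close> and \<open>k\<close> (\<open>signature_matrix_square\<close>). In the
  other direction, a Hermitian \<open>Q\<close> that satisfies such an equation has two eigenvalues, and a
  suitable combination of \<open>I\<close> and \<open>Q\<close> is the projection onto an eigenspace
  (\<open>signature_matrix_of_square\<close>). On the diagonal, \<open>Q\<^sup>2\<close> always has the entries \<open>n - 1\<close>, because \<open>Q\<close> is
  Hermitian with zeros on the diagonal and entries of modulus \<open>1\<close> off it.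

  For groups, the \<open>(i, j)\<close> entry of \<open>Q\<close> is \<open>q (en i \<otimes> inv (en j))\<close>, where \<open>q\<close> is \<open>1\<close> on \<open>S\<close>, \<open>- 1\<close> on \<open>T\<close>
  and \<open>0\<close> at \<open>\<one>\<close>. So \<open>Q\<close> is self-adjoint if and only if \<open>S\<close> and \<open>T\<close> are closed under inverses, and the
  entries of \<open>Q\<^sup>2\<close> are the values of the convolution of \<open>q\<close> with itself. At \<open>g\<close> that value is the
  signed number of factorizations of \<open>g\<close> into elements of \<open>S\<close> and \<open>T\<close> (\<open>sign_coeff_convolution\<close>), so
  that \<open>Q\<^sup>2 = \<mu> Q\<close> off the diagonal is the condition on factorizations in the theorem.
\<close>

section \<open>Gram matrices of Parseval frames\<close>

lemma of_real_norm_square: "(complex_of_real (cmod z))\<^sup>2 = z * cnj z"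
  using complex_norm_square[of z] by simp

lemma cscalar_prod_sum:
  assumes "y \<in> carrier_vec k"
  shows "x \<bullet>c y = (\<Sum>a<k. x $ a * cnj (y $ a))"
  using assms by (simp add: scalar_prod_def atLeast0LessThan)

lemma cscalar_prod_self:
  assumes "x \<in> carrier_vec k"
  shows "x \<bullet>c x = complex_of_real ((cvec_norm x)\<^sup>2)"
proof -
  have "x \<bullet>c x = complex_of_real (\<Sum>a<k. (cmod (x $ a))\<^sup>2)"
    unfolding cscalar_prod_sum[OF assms] by (simp add: of_real_norm_square)
  then show ?thesis
    unfolding cvec_norm_def by (simp add: sum_nonneg del: of_real_sum)
qed

text \<open>
  A nonzero column of a Hermitian idempotent is an eigenvector for the eigenvalue \<open>1\<close>. Splitting off
  the projection onto its line leaves a Hermitian idempotent whose trace has dropped by \<open>1\<close>, and as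
  the trace is the sum of all \<open>\<bar>P i j\<bar>\<^sup>2\<close>, it cannot become negative. The process therefore stops, at
  the zero matrix, after exactly trace many steps. In particular the trace is a natural
  number.
\<close>

lemma hermitian_idempotent_spectral:
  fixes P :: "nat \<Rightarrow> nat \<Rightarrow> complex"
  assumes "\<And>i j. i < n \<Longrightarrow> j < n \<Longrightarrow> P j i = cnj (P i j)"
    and "\<And>i j. i < n \<Longrightarrow> j < n \<Longrightarrow> (\<Sum>l<n. P i l * P l j) = P i j"
  shows "\<exists>k u. (\<forall>a<k. \<forall>b<k. (\<Sum>i<n. u a i * cnj (u b i)) = (if a = b then 1 else 0)) \<and>
               (\<forall>i<n. \<forall>j<n. P i j = (\<Sum>a<(k::nat). u a i * cnj (u a j)))"
proof -
  have diag: "P i i = complex_of_real (\<Sum>l<n. (cmod (P i l))\<^sup>2)"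
    if herm: "\<And>i j. i < n \<Longrightarrow> j < n \<Longrightarrow> P j i = cnj (P i j)"
      and idem: "\<And>i j. i < n \<Longrightarrow> j < n \<Longrightarrow> (\<Sum>l<n. P i l * P l j) = P i j" and i: "i < n"
    for P :: "nat \<Rightarrow> nat \<Rightarrow> complex" and i
  proof -
    have "P i i = (\<Sum>l<n. P i l * P l i)"
      by (rule idem[OF i i, symmetric])
    also have "\<dots> = (\<Sum>l<n. P i l * cnj (P i l))"
      using herm[OF i] by (intro sum.cong) auto
    finally show ?thesis by (simp add: of_real_norm_square)
  qed
  obtain m :: nat where "Re (\<Sum>i<n. P i i) \<le> real m"
    using real_arch_simple by blast
  then show ?thesis using assms
  proof (induction m arbitrary: P)
    case (0 P)
    have "(\<Sum>i<n. \<Sum>l<n. (cmod (P i l))\<^sup>2) \<le> 0"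
      using 0(1) diag[OF 0(2,3)] by simp
    then have "(\<Sum>i<n. \<Sum>l<n. (cmod (P i l))\<^sup>2) = 0"
      by (intro antisym sum_nonneg) auto
    then have "P i l = 0" if "i < n" "l < n" for i l
      using that by (simp add: sum_nonneg_eq_0_iff sum_nonneg)
    then show ?case by (intro exI[of _ 0]) simp
  next
    case (Suc m P)
    note herm = Suc.prems(2) and idem = Suc.prems(3)
    show ?case
    proof (cases "\<forall>i<n. \<forall>j<n. P i j = 0")
      case True
      then show ?thesis by (intro exI[of _ 0]) simp
    next
      case False
      then obtain b c where bc: "b < n" "c < n" "P b c \<noteq> 0" by blast
      \<comment> \<open>Column \<open>b\<close> has squared norm \<open>P b b\<close>; it is normalized to the eigenvector \<open>u\<close>.\<close>
      define r where "r = sqrt (\<Sum>l<n. (cmod (P b l))\<^sup>2)"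
      have "(\<Sum>l<n. (cmod (P b l))\<^sup>2) > 0"
        using bc by (intro sum_pos2[of _ c]) auto
      then have r: "r > 0" "complex_of_real r * complex_of_real r = P b b"
        unfolding r_def using diag[OF herm idem bc(1)]
        by (simp_all flip: of_real_mult)
      define u where "u i = P i b / r" for i
      have cnju: "cnj (u i) = P b i / r" if "i < n" for i
        using herm[OF bc(1) that] unfolding u_def by simp
      have Pu: "(\<Sum>j<n. P i j * u j) = u i" if "i < n" for i
        using idem[OF that bc(1)] unfolding u_def by (simp flip: sum_divide_distrib)
      have uP: "(\<Sum>j<n. cnj (u j) * P j i) = cnj (u i)" if "i < n" for i
        using idem[OF bc(1) that] by (simp add: cnju that flip: sum_divide_distrib)
      have uu: "(\<Sum>i<n. u i * cnj (u i)) = 1"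
      proof -
        have "(\<Sum>i<n. u i * cnj (u i)) = (\<Sum>i<n. P b i * P i b) / (of_real r * of_real r)"
          unfolding sum_divide_distrib by (intro sum.cong) (auto simp: cnju, simp add: u_def)
        moreover have "P b b \<noteq> 0" using r by (metis mult_eq_0_iff of_real_eq_0_iff less_irrefl)
        ultimately show ?thesis using idem[OF bc(1) bc(1)] r(2) by simp
      qed
      define P' where "P' i j = P i j - u i * cnj (u j)" for i j
      have "Re (\<Sum>i<n. P' i i) = Re (\<Sum>i<n. P i i) - Re (\<Sum>i<n. u i * cnj (u i))"
        unfolding P'_def sum_subtractf by simp
      with uu have "Re (\<Sum>i<n. P' i i) = Re (\<Sum>i<n. P i i) - 1" by simp
      with Suc.prems(1) have tr: "Re (\<Sum>i<n. P' i i) \<le> real m" by simp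
      have herm': "P' j i = cnj (P' i j)" if "i < n" "j < n" for i j
        using herm[OF that] by (simp add: P'_def)
      have idem': "(\<Sum>l<n. P' i l * P' l j) = P' i j" if "i < n" "j < n" for i j
      proof -
        have "(\<Sum>l<n. P' i l * P' l j) =
            (\<Sum>l<n. P i l * P l j) - (\<Sum>l<n. P i l * u l) * cnj (u j)
            - u i * (\<Sum>l<n. cnj (u l) * P l j) + u i * (\<Sum>l<n. u l * cnj (u l)) * cnj (u j)"
          unfolding P'_def sum_distrib_left sum_distrib_right sum_subtractf[symmetric]
            sum.distrib[symmetric]
          by (intro sum.cong) (auto simp: algebra_simps)
        then show ?thesis
          using that by (simp add: idem Pu uP uu P'_def)
      qed
      obtain k v where orth: "\<And>a b. a < k \<Longrightarrow> b < k \<Longrightarrow>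
            (\<Sum>i<n. v a i * cnj (v b i)) = (if a = b then 1 else 0)"
        and P'v: "\<And>i j. i < n \<Longrightarrow> j < n \<Longrightarrow> P' i j = (\<Sum>a<(k::nat). v a i * cnj (v a j))"
        using Suc.IH[OF tr herm' idem'] by blast
      \<comment> \<open>As \<open>P'\<close> kills \<open>u\<close>, the sum of the \<open>\<bar>\<langle>v a, u\<rangle>\<bar>\<^sup>2\<close> is \<open>\<langle>P' u, u\<rangle> = 0\<close>.\<close>
      have vu: "(\<Sum>i<n. v a i * cnj (u i)) = 0" if "a < k" for a
      proof -
        define w where "w a = (\<Sum>i<n. cnj (u i) * v a i)" for a
        have "0 = (\<Sum>i<n. cnj (u i) * (\<Sum>j<n. P' i j * u j))"
          using Pu uu by (simp add: P'_def left_diff_distrib sum_subtractf mult.assoc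
              mult.commute[of "cnj _"] flip: sum_distrib_left)
        also have "\<dots> = (\<Sum>i<n. \<Sum>j<n. \<Sum>a<k. (cnj (u i) * v a i) * cnj (cnj (u j) * v a j))"
          unfolding sum_distrib_left
          by (intro sum.cong refl) (simp add: P'v sum_distrib_left sum_distrib_right mult_ac)
        also have "\<dots> = (\<Sum>i<n. \<Sum>a<k. \<Sum>j<n. (cnj (u i) * v a i) * cnj (cnj (u j) * v a j))"
          by (intro sum.cong refl sum.swap)
        also have "\<dots> = (\<Sum>a<k. \<Sum>i<n. \<Sum>j<n. (cnj (u i) * v a i) * cnj (cnj (u j) * v a j))"
          by (rule sum.swap)
        also have "\<dots> = (\<Sum>a<k. w a * cnj (w a))"
          unfolding w_def sum_product cnj_sum ..
        also have "\<dots> = complex_of_real (\<Sum>a<k. (cmod (w a))\<^sup>2)"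
          by (simp add: of_real_norm_square)
        finally have "(\<Sum>a<k. (cmod (w a))\<^sup>2) = 0"
          by (metis of_real_eq_0_iff)
        then have "w a = 0" using that by (simp add: sum_nonneg_eq_0_iff)
        then show ?thesis by (simp add: w_def mult.commute)
      qed
      have uv: "(\<Sum>i<n. u i * cnj (v a i)) = 0" if "a < k" for a
        using arg_cong[OF vu[OF that], of cnj] by (simp add: mult.commute)
      define v' where "v' a = (if a = k then u else v a)" for a
      have "(\<Sum>i<n. v' a i * cnj (v' b i)) = (if a = b then 1 else 0)"
        if "a < Suc k" "b < Suc k" for a b
        using that orth uv vu uu unfolding v'_def by (auto simp: less_Suc_eq)
      moreover have "P i j = (\<Sum>a<Suc k. v' a i * cnj (v' a j))" if "i < n" "j < n" for i j
      proof -
        have "(\<Sum>a<Suc k. v' a i * cnj (v' a j)) = (\<Sum>a<k. v a i * cnj (v a j)) + u i * cnj (u j)"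
          by (simp add: v'_def)
        moreover have "P i j = P' i j + u i * cnj (u j)" by (simp add: P'_def)
        ultimately show ?thesis unfolding P'v[OF that] by simp
      qed
      ultimately show ?thesis by blast
    qed
  qed
qed

text \<open>
  The orthonormal vectors \<open>u a\<close> that span the range of \<open>P\<close> are the columns of an isometry from
  \<open>\<complex>\<^sup>k\<close> to \<open>\<complex>\<^sup>n\<close>; the conjugated rows of that isometry are the frame, and being Parseval is the
  isometry property.
\<close>

lemma idempotent_is_gram_of_parseval_frame:
  fixes P :: "nat \<Rightarrow> nat \<Rightarrow> complex"
  assumes herm: "\<And>i j. i < n \<Longrightarrow> j < n \<Longrightarrow> P j i = cnj (P i j)"
    and idem: "\<And>i j. i < n \<Longrightarrow> j < n \<Longrightarrow> (\<Sum>l<n. P i l * P l j) = P i j"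
  obtains k f where "parseval_frame n k f" "gram_matrix n f = mat n n (\<lambda>(i, j). P i j)"
    "(\<Sum>i<n. P i i) = of_nat k"
proof -
  obtain k u where orth: "\<And>a b. a < k \<Longrightarrow> b < k \<Longrightarrow>
        (\<Sum>i<n. u a i * cnj (u b i)) = (if a = b then 1 else 0)"
    and Pu: "\<And>i j. i < n \<Longrightarrow> j < n \<Longrightarrow> P i j = (\<Sum>a<(k::nat). u a i * cnj (u a j))"
    using hermitian_idempotent_spectral[OF herm idem] by blast
  define f where "f j = vec k (\<lambda>a. cnj (u a j))" for j
  have fc: "f j \<in> carrier_vec k" for j by (simp add: f_def)
  have "(\<Sum>j<n. (cmod (x \<bullet>c f j))\<^sup>2) = (cvec_norm x)\<^sup>2" if x: "x \<in> carrier_vec k" for x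
  proof -
    have "complex_of_real (\<Sum>j<n. (cmod (x \<bullet>c f j))\<^sup>2) =
        (\<Sum>j<n. (\<Sum>a<k. x $ a * u a j) * cnj (\<Sum>b<k. x $ b * u b j))"
      unfolding of_real_sum of_real_power of_real_norm_square cscalar_prod_sum[OF fc]
      by (simp add: f_def)
    also have "\<dots> = (\<Sum>j<n. \<Sum>a<k. \<Sum>b<k. x $ a * cnj (x $ b) * (u a j * cnj (u b j)))"
      unfolding cnj_sum sum_product by (simp add: mult_ac)
    also have "\<dots> = (\<Sum>a<k. \<Sum>j<n. \<Sum>b<k. x $ a * cnj (x $ b) * (u a j * cnj (u b j)))"
      by (rule sum.swap)
    also have "\<dots> = (\<Sum>a<k. \<Sum>b<k. \<Sum>j<n. x $ a * cnj (x $ b) * (u a j * cnj (u b j)))"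
      by (intro sum.cong refl sum.swap)
    also have "\<dots> = (\<Sum>a<k. \<Sum>b<k. if a = b then x $ a * cnj (x $ b) else 0)"
      by (intro sum.cong refl) (simp add: orth flip: sum_distrib_left)
    also have "\<dots> = complex_of_real ((cvec_norm x)\<^sup>2)"
      unfolding cscalar_prod_self[OF x, symmetric] cscalar_prod_sum[OF x] by simp
    finally show ?thesis by (simp only: of_real_eq_iff)
  qed
  then have "parseval_frame n k f"
    unfolding parseval_frame_def using fc by blast
  moreover have "gram_matrix n f = mat n n (\<lambda>(i, j). P i j)"
    unfolding gram_matrix_def
    by (intro eq_matI) (auto simp: cscalar_prod_sum[OF fc] Pu, simp add: f_def mult.commute)
  moreover have "(\<Sum>i<n. P i i) = of_nat k"
  proof -
    have "(\<Sum>i<n. P i i) = (\<Sum>i<n. \<Sum>a<k. u a i * cnj (u a i))"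
      by (simp add: Pu)
    also have "\<dots> = (\<Sum>a<k. \<Sum>i<n. u a i * cnj (u a i))"
      by (rule sum.swap)
    also have "\<dots> = of_nat k" by (simp add: orth)
    finally show ?thesis .
  qed
  ultimately show ?thesis using that by blast
qed

text \<open>
  Polarization: the difference \<open>B\<close> of the two sides is sesquilinear and vanishes on the diagonal, so
  evaluating it at \<open>x + y\<close> and at \<open>x + \<i> y\<close> forces \<open>B x y = 0\<close>.
\<close>

lemma parseval_frame_reconstruction:
  assumes pf: "parseval_frame n k f" and x: "x \<in> carrier_vec k" and y: "y \<in> carrier_vec k"
  shows "(\<Sum>l<n. (x \<bullet>c f l) * (f l \<bullet>c y)) = x \<bullet>c y"
proof -
  have fc: "f l \<in> carrier_vec k" if "l < n" for l
    using pf that unfolding parseval_frame_def by blast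
  define B where "B x y = (\<Sum>l<n. (x \<bullet>c f l) * cnj (y \<bullet>c f l)) - x \<bullet>c y" for x y
  have B0: "B x x = 0" if "x \<in> carrier_vec k" for x
  proof -
    have "(\<Sum>l<n. (x \<bullet>c f l) * cnj (x \<bullet>c f l)) =
        complex_of_real (\<Sum>l<n. (cmod (x \<bullet>c f l))\<^sup>2)"
      by (simp add: of_real_norm_square)
    also have "\<dots> = complex_of_real ((cvec_norm x)\<^sup>2)"
      using pf that unfolding parseval_frame_def by simp
    finally show ?thesis
      unfolding B_def by (simp add: cscalar_prod_self[OF that])
  qed
  have expand: "B (x + c \<cdot>\<^sub>v y) (x + c \<cdot>\<^sub>v y) = B x x + cnj c * B x y + c * B y x + c * cnj c * B y y"
    for c
  proof -
    have lin: "(x + c \<cdot>\<^sub>v y) \<bullet>c z = x \<bullet>c z + c * (y \<bullet>c z)" if "z \<in> carrier_vec k" for z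
      unfolding cscalar_prod_sum[OF that] sum_distrib_left sum.distrib[symmetric] using x y
      by (intro sum.cong refl) (auto simp: algebra_simps)
    have sesq: "z \<bullet>c (x + c \<cdot>\<^sub>v y) = z \<bullet>c x + cnj c * (z \<bullet>c y)" for z
    proof -
      have xy: "x + c \<cdot>\<^sub>v y \<in> carrier_vec k" using x y by simp
      show ?thesis
        unfolding cscalar_prod_sum[OF x] cscalar_prod_sum[OF y] cscalar_prod_sum[OF xy]
          sum_distrib_left sum.distrib[symmetric]
        using x y by (intro sum.cong refl) (auto simp: algebra_simps)
    qed
    have 1: "(\<Sum>l<n. ((x + c \<cdot>\<^sub>v y) \<bullet>c f l) * cnj ((x + c \<cdot>\<^sub>v y) \<bullet>c f l)) =
       (\<Sum>l<n. (x \<bullet>c f l) * cnj (x \<bullet>c f l)) + cnj c * (\<Sum>l<n. (x \<bullet>c f l) * cnj (y \<bullet>c f l))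
       + c * (\<Sum>l<n. (y \<bullet>c f l) * cnj (x \<bullet>c f l)) + c * cnj c * (\<Sum>l<n. (y \<bullet>c f l) * cnj (y \<bullet>c f l))"
      unfolding sum_distrib_left sum.distrib[symmetric]
      by (intro sum.cong refl) (simp add: lin fc algebra_simps)
    have 2: "(x + c \<cdot>\<^sub>v y) \<bullet>c (x + c \<cdot>\<^sub>v y) =
        x \<bullet>c x + cnj c * (x \<bullet>c y) + c * (y \<bullet>c x) + c * cnj c * (y \<bullet>c y)"
      unfolding sesq by (simp add: lin x y algebra_simps)
    show ?thesis unfolding B_def 1 2 by (simp add: algebra_simps)
  qed
  have "B x y + B y x = 0"
    using expand[of 1] x y by (simp add: B0)
  moreover have "- \<i> * B x y + \<i> * B y x = 0"
    using expand[of \<i>] x y by (simp add: B0)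
  then have "\<i> * (B y x - B x y) = 0"
    by (simp add: algebra_simps)
  then have "B y x - B x y = 0" by simp
  ultimately have "B x y = 0" by simp
  moreover have "cnj (y \<bullet>c f l) = f l \<bullet>c y" if "l < n" for l
    unfolding cscalar_prod_sum[OF fc[OF that]] cscalar_prod_sum[OF y]
    by (simp add: mult.commute)
  ultimately show ?thesis unfolding B_def by simp
qed

lemma gram_matrix_idempotent:
  assumes pf: "parseval_frame n k f" and "i < n" "j < n"
  shows "(\<Sum>l<n. gram_matrix n f $$ (i, l) * gram_matrix n f $$ (l, j)) = gram_matrix n f $$ (i, j)"
proof -
  have "f i \<in> carrier_vec k" "f j \<in> carrier_vec k"
    using assms unfolding parseval_frame_def by blast+
  from parseval_frame_reconstruction[OF pf this(2,1)] show ?thesis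
    using assms by (simp add: gram_matrix_def mult.commute)
qed

section \<open>Signature matrices and their quadratic equation\<close>

lemma mat_adjoint_eq_self_iff:
  assumes Q: "Q \<in> carrier_mat n n"
  shows "mat_adjoint Q = Q \<longleftrightarrow> (\<forall>i<n. \<forall>j<n. Q $$ (j, i) = cnj (Q $$ (i, j)))"
proof -
  have dim: "mat_adjoint Q \<in> carrier_mat n n"
    using Q unfolding mat_adjoint_def by auto
  have entry: "mat_adjoint Q $$ (j, i) = cnj (Q $$ (i, j))" if "i < n" "j < n" for i j
    using Q that unfolding mat_adjoint_def by (simp add: mat_of_rows_index)
  show ?thesis
  proof
    assume self: "mat_adjoint Q = Q"
    show "\<forall>i<n. \<forall>j<n. Q $$ (j, i) = cnj (Q $$ (i, j))"
      using entry unfolding self by blast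
  next
    assume h: "\<forall>i<n. \<forall>j<n. Q $$ (j, i) = cnj (Q $$ (i, j))"
    show "mat_adjoint Q = Q"
    proof (rule eq_matI)
      fix i j assume "i < dim_row Q" "j < dim_col Q"
      then have ij: "i < n" "j < n" using Q by auto
      show "mat_adjoint Q $$ (i, j) = Q $$ (i, j)"
        unfolding entry[OF ij(2,1)] by (rule h[rule_format, OF ij(2,1), symmetric])
    qed (use Q dim in auto)
  qed
qed

text \<open>The \<open>(i, j)\<close> entry of the square of \<open>a I + c Q\<close>.\<close>

lemma square_scalar_plus:
  fixes Q :: "nat \<Rightarrow> nat \<Rightarrow> 'a :: comm_ring_1"
  assumes "i < n" "j < n"
  shows "(\<Sum>l<n. ((if i = l then a else 0) + c * Q i l) * ((if l = j then a else 0) + c * Q l j)) =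
    (if i = j then a\<^sup>2 else 0) + 2 * a * c * Q i j + c\<^sup>2 * (\<Sum>l<n. Q i l * Q l j)"
proof -
  have expand: "(x + c * p) * (y + c * r) = x * y + x * (c * r) + y * (c * p) + c\<^sup>2 * (p * r)" for x y p r
    by (simp add: algebra_simps power2_eq_square)
  have delta: "(if b then x else 0) * y = (if b then x * y else 0)" for b and x y :: 'a
    by simp
  have "(\<Sum>l<n. (if i = l then a else 0) * (if l = j then a else 0)) = (if i = j then a\<^sup>2 else 0)"
    using assms by (simp add: delta power2_eq_square)
  moreover have "(\<Sum>l<n. (if i = l then a else 0) * (c * Q l j)) = a * c * Q i j"
    using assms by (simp add: delta mult.assoc)
  moreover have "(\<Sum>l<n. (if l = j then a else 0) * (c * Q i l)) = a * c * Q i j"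
    using assms by (simp add: delta mult.assoc)
  ultimately show ?thesis
    unfolding expand sum.distrib sum_distrib_left by (simp only: mult_2 distrib_right add.assoc)
qed

lemma hermitian_unimodular_square_diag:
  assumes herm: "\<And>i j. i < n \<Longrightarrow> j < n \<Longrightarrow> Q j i = cnj (Q i j)"
    and diag: "\<And>i. i < n \<Longrightarrow> Q i i = 0"
    and uni: "\<And>i j. i < n \<Longrightarrow> j < n \<Longrightarrow> i \<noteq> j \<Longrightarrow> cmod (Q i j) = 1"
    and i: "i < n"
  shows "(\<Sum>l<n. Q i l * Q l i) = of_nat (n - 1)"
proof -
  have "(\<Sum>l<n. Q i l * Q l i) = (\<Sum>l<n. if l = i then 0 else 1)"
  proof (intro sum.cong refl)
    fix l assume "l \<in> {..<n}"
    then have l: "l < n" by simp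
    have "Q i l * Q l i = complex_of_real ((cmod (Q i l))\<^sup>2)"
      using herm[OF i l] by (simp add: of_real_norm_square)
    then show "Q i l * Q l i = (if l = i then 0 else 1)"
      using uni[OF i l] diag[OF i] by auto
  qed
  also have "\<dots> = of_nat (card ({..<n} - {i}))"
    by (simp add: sum.If_cases Diff_eq)
  finally show ?thesis using i by simp
qed

text \<open>
  The number \<open>\<mu>\<close> with \<open>Q\<^sup>2 = (n - 1) I + \<mu> Q\<close>, that is, the sum of the two eigenvalues of the signature
  matrix \<open>Q\<close> of an \<open>(n, k)\<close>-equiangular frame.
\<close>

definition signature_mu :: "nat \<Rightarrow> nat \<Rightarrow> real" where
  "signature_mu n k = (real n - 2 * real k) * sqrt ((real n - 1) / (real k * (real n - real k)))"

lemma signature_mu_frame_const: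
  assumes "1 \<le> k" "k < n"
  shows "frame_const n k > 0" "frame_const n k * signature_mu n k = 1 - 2 * (real k / real n)"
proof -
  have pos: "real k > 0" "real n - real k > 0" "real n - 1 > 0" "real n > 0"
    using assms by auto
  have c: "frame_const n k = sqrt (real k * (real n - real k)) / (real n * sqrt (real n - 1))"
    unfolding frame_const_def using pos by (simp add: real_sqrt_divide real_sqrt_mult)
  then show "frame_const n k > 0" using pos by simp
  have mu: "signature_mu n k =
      (real n - 2 * real k) * (sqrt (real n - 1) / sqrt (real k * (real n - real k)))"
    unfolding signature_mu_def by (simp add: real_sqrt_divide)
  have "sqrt (real n - 1) > 0" "sqrt (real k * (real n - real k)) > 0"
    using pos by simp_all
  then show "frame_const n k * signature_mu n k = 1 - 2 * (real k / real n)"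
    unfolding c mu using pos by (simp add: field_simps)
qed

text \<open>
  The formula for \<open>\<mu>\<close> can be inverted because \<open>4 k (n - k) + (n - 2 k)\<^sup>2 = n\<^sup>2\<close>, which makes
  \<open>sqrt (4 (n - 1) + \<mu>\<^sup>2)\<close> equal to \<open>n s\<close> with \<open>s\<close> the square root that occurs in \<open>\<mu>\<close>.
\<close>

lemma signature_mu_determines_rank:
  assumes "1 \<le> k" "k < n" and "\<mu> = signature_mu n k"
  shows "real k = real n / 2 - \<mu> * real n / (2 * sqrt (4 * (real n - 1) + \<mu>\<^sup>2))"
proof -
  have pos: "real k > 0" "real n - real k > 0" "real n - 1 > 0" "real n > 0"
    using assms by auto
  define s where "s = sqrt ((real n - 1) / (real k * (real n - real k)))"
  have s: "s > 0" "s\<^sup>2 * (real k * (real n - real k)) = real n - 1"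
    unfolding s_def using pos by simp_all
  have mu: "\<mu> = (real n - 2 * real k) * s"
    unfolding assms signature_mu_def s_def ..
  have "4 * (real n - 1) + \<mu>\<^sup>2 = (s * real n)\<^sup>2"
    unfolding s(2)[symmetric] mu by (simp add: power2_eq_square algebra_simps)
  then have "sqrt (4 * (real n - 1) + \<mu>\<^sup>2) = s * real n"
    using s pos by simp
  then show ?thesis
    unfolding mu using s pos by (simp add: field_simps)
qed

text \<open>
  Compare the off-diagonal entries of \<open>P\<^sup>2 = P\<close> for the Gram matrix \<open>P = a I + c Q\<close>, where \<open>a = k / n\<close>
  and \<open>c = frame_const n k\<close>.
\<close>

lemma signature_matrix_square:
  assumes sig: "signature_matrix n k Q" and ij: "i < n" "j < n" "i \<noteq> j"
  shows "(\<Sum>l<n. Q $$ (i, l) * Q $$ (l, j)) = complex_of_real (signature_mu n k) * Q $$ (i, j)"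
proof -
  define a c where "a = complex_of_real (real k / real n)" and "c = complex_of_real (frame_const n k)"
  define q where "q i j = Q $$ (i, j)" for i j
  from sig obtain f where k: "1 \<le> k" "k < n" and Q: "Q \<in> carrier_mat n n"
    and pf: "parseval_frame n k f" and gram: "gram_matrix n f = a \<cdot>\<^sub>m 1\<^sub>m n + c \<cdot>\<^sub>m Q"
    unfolding signature_matrix_def equiangular_frame_def a_def c_def by blast
  have entry: "gram_matrix n f $$ (i, j) = (if i = j then a else 0) + c * q i j"
    if "i < n" "j < n" for i j
    using Q that by (simp add: gram q_def)
  have eq: "2 * a * c * q i j + c\<^sup>2 * (\<Sum>l<n. q i l * q l j) = c * q i j"
    using gram_matrix_idempotent[OF pf ij(1,2)] square_scalar_plus[OF ij(1,2), of a c q] ij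
    by (simp add: entry)
  have "c \<noteq> 0" using signature_mu_frame_const(1)[OF k] by (simp add: c_def)
  have mu: "1 - 2 * a = c * complex_of_real (signature_mu n k)"
    unfolding a_def c_def of_real_mult[symmetric] signature_mu_frame_const(2)[OF k] by simp
  have "c\<^sup>2 * (\<Sum>l<n. q i l * q l j) = c * q i j - 2 * a * c * q i j"
    unfolding eq[symmetric] by (rule add_diff_cancel_left'[symmetric])
  also have "\<dots> = c * q i j * (1 - 2 * a)" by (simp add: algebra_simps)
  also have "\<dots> = c\<^sup>2 * (complex_of_real (signature_mu n k) * q i j)"
    unfolding mu by (simp add: power2_eq_square)
  finally have "c\<^sup>2 * (\<Sum>l<n. q i l * q l j) = c\<^sup>2 * (complex_of_real (signature_mu n k) * q i j)" .
  with \<open>c \<noteq> 0\<close> show ?thesis by (simp add: q_def)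
qed

text \<open>
  The equation \<open>Q\<^sup>2 = (n - 1) I + \<mu> Q\<close> says that the eigenvalues of \<open>Q\<close> are the roots \<open>(\<mu> \<plusminus> D) / 2\<close> of
  \<open>x\<^sup>2 = (n - 1) + \<mu> x\<close>. The projection onto the eigenspace of the larger root is
  \<open>P = a I + Q / D\<close> with \<open>a = (D - \<mu>) / (2 D)\<close>, and its trace \<open>n a\<close> is the dimension \<open>k\<close>. As
  \<open>0 < a < 1\<close>, this is a number strictly between \<open>0\<close> and \<open>n\<close>. Since all diagonal entries of \<open>P\<close> are \<open>a\<close>
  and all others have modulus \<open>1 / D\<close>, a Parseval frame with Gram matrix \<open>P\<close> is equiangular.
\<close>

lemma signature_matrix_of_square:
  assumes n: "n \<ge> 2" and Q: "Q \<in> carrier_mat n n" and herm: "mat_adjoint Q = Q"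
    and diag: "\<And>i. i < n \<Longrightarrow> Q $$ (i, i) = 0"
    and uni: "\<And>i j. i < n \<Longrightarrow> j < n \<Longrightarrow> i \<noteq> j \<Longrightarrow> cmod (Q $$ (i, j)) = 1"
    and sq: "\<And>i j. i < n \<Longrightarrow> j < n \<Longrightarrow> i \<noteq> j \<Longrightarrow>
      (\<Sum>l<n. Q $$ (i, l) * Q $$ (l, j)) = complex_of_real \<mu> * Q $$ (i, j)"
  shows "\<exists>k. signature_matrix n k Q"
proof -
  define q where "q i j = Q $$ (i, j)" for i j
  have hermq: "q j i = cnj (q i j)" if "i < n" "j < n" for i j
    using herm that unfolding mat_adjoint_eq_self_iff[OF Q] q_def by blast
  have n1: "real n - 1 > 0" using n by simp
  define D where "D = sqrt (4 * (real n - 1) + \<mu>\<^sup>2)"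
  have D2: "D\<^sup>2 = 4 * (real n - 1) + \<mu>\<^sup>2"
    unfolding D_def using n1 by simp
  have D0: "D > 0" unfolding D_def using n1 by (simp add: add_pos_nonneg)
  have "\<bar>\<mu>\<bar> < D"
  proof (rule power2_less_imp_less)
    show "\<bar>\<mu>\<bar>\<^sup>2 < D\<^sup>2" unfolding D2 using n1 by simp
  qed (use D0 in simp)
  then have mu: "- D < \<mu>" "\<mu> < D" by auto
  define a where "a = (D - \<mu>) / (2 * D)"
  have a01: "0 < a" "a < 1" unfolding a_def using mu D0 by (simp_all add: field_simps)
  \<comment> \<open>\<open>quad\<close> and \<open>lin\<close> are \<open>P\<^sup>2 = P\<close> on the diagonal and off it; \<open>quad\<close> later identifies
    \<open>1 / D\<close> as \<open>frame_const n k\<close>.\<close>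
  have quad: "a - a\<^sup>2 = (real n - 1) / D\<^sup>2"
  proof -
    have "a - a\<^sup>2 = (D\<^sup>2 - \<mu>\<^sup>2) / (4 * D\<^sup>2)"
      unfolding a_def using D0 by (simp add: field_simps power2_eq_square)
    also have "D\<^sup>2 - \<mu>\<^sup>2 = 4 * (real n - 1)" unfolding D2 by simp
    finally show ?thesis using D0 by (simp add: divide_simps)
  qed
  have lin: "2 * a / D + \<mu> / D\<^sup>2 = 1 / D"
    unfolding a_def using D0 by (simp add: field_simps power2_eq_square)
  define P where "P i j = (if i = j then complex_of_real a else 0) + complex_of_real (1 / D) * q i j" for i j
  have hermP: "P j i = cnj (P i j)" if "i < n" "j < n" for i j
    using hermq[OF that] by (auto simp: P_def)
  have idem: "(\<Sum>l<n. P i l * P l j) = P i j" if ij: "i < n" "j < n" for i j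
  proof -
    note expand = square_scalar_plus[OF ij, of "complex_of_real a" "complex_of_real (1 / D)" q,
        folded P_def]
    show ?thesis
    proof (cases "i = j")
      case True
      have "(\<Sum>l<n. q i l * q l i) = of_nat (n - 1)"
        by (rule hermitian_unimodular_square_diag[OF hermq _ _ ij(1)])
          (simp_all add: q_def diag uni)
      also have "\<dots> = complex_of_real (real n - 1)" using n by (simp add: of_nat_diff)
      finally have "(\<Sum>l<n. P i l * P l j) = complex_of_real (a\<^sup>2 + (1 / D)\<^sup>2 * (real n - 1))"
        using expand True diag[OF ij(1)] by (simp add: q_def)
      also have "a\<^sup>2 + (1 / D)\<^sup>2 * (real n - 1) = a"
        using quad by (simp add: power_divide)
      finally show ?thesis using True diag[OF ij(1)] by (simp add: P_def q_def)
    next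
      case False
      have "(\<Sum>l<n. P i l * P l j) = complex_of_real (2 * a / D + \<mu> / D\<^sup>2) * q i j"
        unfolding expand using False sq[OF ij False]
        by (simp add: q_def algebra_simps power_divide)
      then show ?thesis unfolding lin using False by (simp add: P_def)
    qed
  qed
  obtain k f where pf: "parseval_frame n k f"
    and gram: "gram_matrix n f = mat n n (\<lambda>(i, j). P i j)"
    and tr: "(\<Sum>i<n. P i i) = of_nat k"
    using idempotent_is_gram_of_parseval_frame[OF hermP idem] by blast
  have "complex_of_real (real n * a) = complex_of_real (real k)"
    using tr diag by (simp add: P_def q_def)
  then have k: "real k = real n * a" by (simp only: of_real_eq_iff)
  then have "0 < real k" "real k < real n"
    using a01 n by simp_all
  then have k1: "1 \<le> k" "k < n" by simp_all
  have kn: "real k / real n = a" using k n by simp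
  have c: "frame_const n k = 1 / D"
  proof -
    have "real k * (real n - real k) / ((real n)\<^sup>2 * (real n - 1)) = (a - a\<^sup>2) / (real n - 1)"
      unfolding k using n n1 by (simp add: field_simps power2_eq_square)
    also have "\<dots> = (1 / D)\<^sup>2" unfolding quad using n1 by (simp add: power_divide)
    finally show ?thesis unfolding frame_const_def using D0 by simp
  qed
  have entry: "f j \<bullet>c f i = P i j" if "i < n" "j < n" for i j
    using arg_cong[OF gram, of "\<lambda>M. M $$ (i, j)"] that by (simp add: gram_matrix_def)
  have fc: "f i \<in> carrier_vec k" if "i < n" for i
    using pf that unfolding parseval_frame_def by blast
  have Pii: "P i i = complex_of_real a" if "i < n" for i
    using diag[OF that] by (simp add: P_def q_def)
  have norm: "cvec_norm (f i) = sqrt a" if "i < n" for i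
    unfolding cvec_norm_def entry[OF that that] Pii[OF that] by simp
  have "f i \<noteq> 0\<^sub>v k" if "i < n" for i
  proof
    assume "f i = 0\<^sub>v k"
    then have "f i \<bullet>c f i = 0" by simp
    then show False
      using a01 unfolding entry[OF that that] Pii[OF that] by simp
  qed
  moreover have "cmod (cvec_normalize (f i) \<bullet>c cvec_normalize (f j)) = 1 / (a * D)"
    if "i < n" "j < n" "i \<noteq> j" for i j
  proof -
    have 1: "cvec_normalize (f i) \<bullet>c cvec_normalize (f j) =
        complex_of_real (1 / (cvec_norm (f i) * cvec_norm (f j))) * (f i \<bullet>c f j)"
      unfolding cvec_normalize_def using fc[OF that(1)] fc[OF that(2)]
      by (simp add: conjugate_smult_vec)
    have 2: "cvec_norm (f i) * cvec_norm (f j) = a"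
      using a01 that by (simp add: norm)
    have "f i \<bullet>c f j = complex_of_real (1 / D) * q j i"
      using entry[OF that(2,1)] that(3) by (simp add: P_def)
    then show ?thesis
      unfolding 1 2 using uni[OF that(2,1)] that(3) a01 D0 by (simp add: norm_mult norm_divide q_def)
  qed
  ultimately have "equiangular_frame n k f"
    unfolding equiangular_frame_def using pf by blast
  moreover have "gram_matrix n f =
      complex_of_real (real k / real n) \<cdot>\<^sub>m 1\<^sub>m n + complex_of_real (frame_const n k) \<cdot>\<^sub>m Q"
    unfolding gram kn c using Q by (intro eq_matI) (auto simp: P_def q_def)
  ultimately show ?thesis
    unfolding signature_matrix_def using k1 Q herm diag uni by blast
qed

section \<open>Squaring in the group algebra\<close>

lemma finsum_module_mat:
  fixes F :: "'i \<Rightarrow> 'a :: comm_ring_1 mat"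
  assumes "finite A" and F: "\<And>a. a \<in> A \<Longrightarrow> F a \<in> carrier_mat nr nc"
  shows "finsum (module_mat TYPE('a) nr nc) F A \<in> carrier_mat nr nc"
    and "i < nr \<Longrightarrow> j < nc \<Longrightarrow>
      finsum (module_mat TYPE('a) nr nc) F A $$ (i, j) = (\<Sum>a\<in>A. F a $$ (i, j))"
proof -
  interpret M: abelian_group "module_mat TYPE('a) nr nc" by (rule abelian_group_mat)
  have "finsum (module_mat TYPE('a) nr nc) F A \<in> carrier_mat nr nc \<and>
     (i < nr \<longrightarrow> j < nc \<longrightarrow>
      finsum (module_mat TYPE('a) nr nc) F A $$ (i, j) = (\<Sum>a\<in>A. F a $$ (i, j)))"
    using assms
  proof (induction A rule: finite_induct)
    case empty
    then show ?case by (simp add: module_mat_simps)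
  next
    case (insert x A)
    then have "finsum (module_mat TYPE('a) nr nc) F (insert x A) =
        F x + finsum (module_mat TYPE('a) nr nc) F A"
      by (subst M.finsum_insert) (auto simp: module_mat_simps Pi_def)
    moreover have "finsum (module_mat TYPE('a) nr nc) F A \<in> carrier_mat nr nc"
      using insert by blast
    ultimately show ?case using insert by (auto simp: carrier_matD)
  qed
  then show "finsum (module_mat TYPE('a) nr nc) F A \<in> carrier_mat nr nc"
    and "i < nr \<Longrightarrow> j < nc \<Longrightarrow>
      finsum (module_mat TYPE('a) nr nc) F A $$ (i, j) = (\<Sum>a\<in>A. F a $$ (i, j))"
    by blast+
qed

text \<open>
  The coefficients of the element \<open>\<Sum>g\<in>S. g - \<Sum>h\<in>T. h\<close> of the group algebra, where \<open>T\<close> is the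
  complement of \<open>S\<close> in \<open>G - {\<one>}\<close>.
\<close>

definition sign_coeff :: "('a, 'b) monoid_scheme \<Rightarrow> 'a set \<Rightarrow> 'a \<Rightarrow> real" where
  "sign_coeff G S g = (if g = \<one>\<^bsub>G\<^esub> then 0 else if g \<in> S then 1 else - 1)"

definition signed_product_count :: "('a, 'b) monoid_scheme \<Rightarrow> 'a set \<Rightarrow> 'a set \<Rightarrow> 'a \<Rightarrow> real" where
  "signed_product_count G S T g =
     real (num_prod G S S g) - 2 * real (num_prod G S T g) + real (num_prod G T T g)"

context group
begin

lemma inv_cancel_left:
  assumes "x \<in> carrier G" "y \<in> carrier G"
  shows "x \<otimes> (inv x \<otimes> y) = y" "inv x \<otimes> (x \<otimes> y) = y"
  using assms by (simp_all flip: m_assoc)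

lemma num_prod_eq_sum:
  assumes fin: "finite (carrier G)" and A: "A \<subseteq> carrier G" and B: "B \<subseteq> carrier G"
    and g: "g \<in> carrier G"
  shows "real (num_prod G A B g) = (\<Sum>x\<in>carrier G. of_bool (x \<in> A) * of_bool (inv x \<otimes> g \<in> B))"
proof -
  have "bij_betw fst {(x, y) \<in> A \<times> B. x \<otimes> y = g} {x \<in> carrier G. x \<in> A \<and> inv x \<otimes> g \<in> B}"
  proof (rule bij_betwI[where g = "\<lambda>x. (x, inv x \<otimes> g)"])
    have y: "x \<in> carrier G" "x \<in> A" "inv x \<otimes> g \<in> B" "inv x \<otimes> g = y"
      if "x \<in> A" "y \<in> B" "x \<otimes> y = g" for x y
    proof -
      show "x \<in> A" "x \<in> carrier G" using that A by blast+
      have "y \<in> carrier G" using that B by blast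
      with \<open>x \<in> carrier G\<close> show "inv x \<otimes> g = y"
        unfolding that(3)[symmetric] by (rule inv_cancel_left(2))
      with that show "inv x \<otimes> g \<in> B" by simp
    qed
    show "fst \<in> {(x, y) \<in> A \<times> B. x \<otimes> y = g} \<rightarrow> {x \<in> carrier G. x \<in> A \<and> inv x \<otimes> g \<in> B}"
    proof (rule funcsetI)
      fix p assume "p \<in> {(x, y) \<in> A \<times> B. x \<otimes> y = g}"
      then have p: "fst p \<in> A" "snd p \<in> B" "fst p \<otimes> snd p = g" by auto
      show "fst p \<in> {x \<in> carrier G. x \<in> A \<and> inv x \<otimes> g \<in> B}"
        using y[OF p] by simp
    qed
    show "(\<lambda>x. (x, inv x \<otimes> g)) \<in> {x \<in> carrier G. x \<in> A \<and> inv x \<otimes> g \<in> B} \<rightarrow>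
        {(x, y) \<in> A \<times> B. x \<otimes> y = g}"
      using g by (intro funcsetI) (simp add: inv_cancel_left)
    show "(fst p, inv (fst p) \<otimes> g) = p" if "p \<in> {(x, y) \<in> A \<times> B. x \<otimes> y = g}" for p
      using that y(4)[of "fst p" "snd p"] by (simp add: split_beta)
  qed simp
  then have "num_prod G A B g = card {x \<in> carrier G. x \<in> A \<and> inv x \<otimes> g \<in> B}"
    unfolding num_prod_def by (rule bij_betw_same_card)
  also have "real \<dots> = (\<Sum>x\<in>carrier G. of_bool (x \<in> A \<and> inv x \<otimes> g \<in> B))"
    using fin by (simp add: Int_def)
  finally show ?thesis by (simp add: of_bool_conj)
qed

lemma sum_translate_inverse:
  assumes g: "g \<in> carrier G"
  shows "(\<Sum>x\<in>carrier G. f (inv x \<otimes> g)) = (\<Sum>x\<in>carrier G. f x)"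
  by (rule sum.reindex_bij_witness[where i = "\<lambda>y. g \<otimes> inv y" and j = "\<lambda>x. inv x \<otimes> g"])
    (use g in \<open>auto simp: inv_mult_group m_assoc inv_cancel_left\<close>)

text \<open>
  In the group algebra, \<open>T\<close> is the sum of all group elements minus \<open>\<one>\<close> minus \<open>S\<close>. The sum of all
  group elements and \<open>\<one>\<close> are central, so the elements given by \<open>S\<close> and \<open>T\<close> commute, even if \<open>G\<close> is
  not abelian. This is why the cross terms of \<open>(S - T)\<^sup>2\<close> add up to \<open>- 2\<close> times the products counted
  from \<open>S \<times> T\<close>. The proof compares coefficients: \<open>s\<close> and \<open>e\<close> are those of \<open>S\<close> and of \<open>\<one>\<close>.
\<close>

lemma num_prod_complement_commute:
  assumes fin: "finite (carrier G)" and S: "S \<subseteq> carrier G - {\<one>}"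
    and T: "T = (carrier G - {\<one>}) - S" and g: "g \<in> carrier G"
  shows "num_prod G S T g = num_prod G T S g"
proof -
  define s where "s x = (of_bool (x \<in> S) :: real)" for x
  define e where "e x = (of_bool (x = \<one>) :: real)" for x
  have t: "of_bool (x \<in> T) = 1 - e x - s x" if "x \<in> carrier G" for x
    using that S by (auto simp: T s_def e_def)
  have e: "(\<Sum>x\<in>carrier G. s x * e (inv x \<otimes> g)) = s g"
  proof -
    have "inv x \<otimes> g = \<one> \<longleftrightarrow> x = g" if "x \<in> carrier G" for x
      using that g by (metis inv_solve_left' r_one one_closed)
    then have "(\<Sum>x\<in>carrier G. s x * e (inv x \<otimes> g)) = (\<Sum>x\<in>carrier G. if x = g then s x else 0)"
      by (intro sum.cong) (auto simp: e_def)
    then show ?thesis using fin g by simp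
  qed
  have e': "(\<Sum>x\<in>carrier G. e x * s (inv x \<otimes> g)) = s g"
  proof -
    have "(\<Sum>x\<in>carrier G. e x * s (inv x \<otimes> g)) =
        (\<Sum>x\<in>carrier G. if x = \<one> then s (inv x \<otimes> g) else 0)"
      by (intro sum.cong) (auto simp: e_def)
    then show ?thesis using fin g by simp
  qed
  have ST: "S \<subseteq> carrier G" "T \<subseteq> carrier G" using S T by auto
  have "real (num_prod G S T g) = (\<Sum>x\<in>carrier G. s x * (1 - e (inv x \<otimes> g) - s (inv x \<otimes> g)))"
    unfolding num_prod_eq_sum[OF fin ST g]
    by (intro sum.cong refl) (simp add: t g flip: s_def)
  also have "\<dots> = (\<Sum>x\<in>carrier G. s x) - s g - (\<Sum>x\<in>carrier G. s x * s (inv x \<otimes> g))"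
    unfolding e[symmetric] sum_subtractf[symmetric]
    by (intro sum.cong) (auto simp: algebra_simps)
  also have "(\<Sum>x\<in>carrier G. s x) = (\<Sum>x\<in>carrier G. s (inv x \<otimes> g))"
    by (rule sum_translate_inverse[OF g, symmetric])
  also have "\<dots> - s g - (\<Sum>x\<in>carrier G. s x * s (inv x \<otimes> g)) =
      (\<Sum>x\<in>carrier G. (1 - e x - s x) * s (inv x \<otimes> g))"
    unfolding e'[symmetric] sum_subtractf[symmetric]
    by (intro sum.cong) (auto simp: algebra_simps)
  also have "\<dots> = real (num_prod G T S g)"
    unfolding num_prod_eq_sum[OF fin ST(2,1) g]
    by (intro sum.cong refl) (simp add: t g flip: s_def)
  finally show ?thesis by simp
qed

lemma sign_coeff_convolution:
  assumes fin: "finite (carrier G)" and S: "S \<subseteq> carrier G - {\<one>}"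
    and T: "T = (carrier G - {\<one>}) - S" and g: "g \<in> carrier G"
  shows "(\<Sum>x\<in>carrier G. sign_coeff G S x * sign_coeff G S (inv x \<otimes> g)) = signed_product_count G S T g"
proof -
  have c: "sign_coeff G S x = of_bool (x \<in> S) - of_bool (x \<in> T)" if "x \<in> carrier G" for x
    using that S by (auto simp: sign_coeff_def T)
  have "(\<Sum>x\<in>carrier G. sign_coeff G S x * sign_coeff G S (inv x \<otimes> g)) =
      (\<Sum>x\<in>carrier G. of_bool (x \<in> S) * of_bool (inv x \<otimes> g \<in> S))
      - (\<Sum>x\<in>carrier G. of_bool (x \<in> S) * of_bool (inv x \<otimes> g \<in> T))
      - (\<Sum>x\<in>carrier G. of_bool (x \<in> T) * of_bool (inv x \<otimes> g \<in> S))
      + (\<Sum>x\<in>carrier G. of_bool (x \<in> T) * of_bool (inv x \<otimes> g \<in> T))"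
    unfolding sum_subtractf[symmetric] sum.distrib[symmetric]
    by (intro sum.cong refl) (use g in \<open>simp add: c algebra_simps\<close>)
  also have "\<dots> = real (num_prod G S S g) - real (num_prod G S T g)
      - real (num_prod G T S g) + real (num_prod G T T g)"
  proof -
    have "S \<subseteq> carrier G" "T \<subseteq> carrier G" using S T by auto
    then show ?thesis by (simp only: num_prod_eq_sum[OF fin _ _ g])
  qed
  also have "\<dots> = signed_product_count G S T g"
    using num_prod_complement_commute[OF assms] by (simp add: signed_product_count_def)
  finally show ?thesis .
qed

text \<open>
  With \<open>f = h = sign_coeff G S\<close>, this says that squaring the matrix with \<open>(i, j)\<close> entry
  \<open>f (en i \<otimes> inv (en j))\<close> amounts to squaring in the group algebra.
\<close>

lemma sum_translates_eq_convolution: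
  assumes en: "bij_betw en {..<n} (carrier G)" and a: "a \<in> carrier G" and b: "b \<in> carrier G"
  shows "(\<Sum>l<n. f (a \<otimes> inv (en l)) * h (en l \<otimes> inv b)) =
    (\<Sum>x\<in>carrier G. f x * h (inv x \<otimes> (a \<otimes> inv b)))"
proof -
  have "(\<Sum>l<n. f (a \<otimes> inv (en l)) * h (en l \<otimes> inv b)) =
      (\<Sum>y\<in>carrier G. f (a \<otimes> inv y) * h (y \<otimes> inv b))"
    using sum.reindex_bij_betw[OF en, of "\<lambda>y. f (a \<otimes> inv y) * h (y \<otimes> inv b)"] .
  also have "\<dots> = (\<Sum>x\<in>carrier G. f x * h (inv x \<otimes> (a \<otimes> inv b)))"
    by (rule sum.reindex_bij_witness[where i = "\<lambda>x. inv x \<otimes> a" and j = "\<lambda>y. a \<otimes> inv y"])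
      (use a b in \<open>auto simp: inv_mult_group m_assoc inv_cancel_left\<close>)
  finally show ?thesis .
qed

lemma sum_left_regular_entry:
  assumes fin: "finite (carrier G)" and en: "bij_betw en {..<n} (carrier G)"
    and A: "A \<subseteq> carrier G"
  shows "finsum (module_mat TYPE(complex) n n) (left_regular G n en) A \<in> carrier_mat n n"
    and "i < n \<Longrightarrow> j < n \<Longrightarrow>
      finsum (module_mat TYPE(complex) n n) (left_regular G n en) A $$ (i, j) =
        of_bool (en i \<otimes> inv (en j) \<in> A)"
proof -
  have finA: "finite A" using A fin finite_subset by blast
  have lr: "left_regular G n en g \<in> carrier_mat n n" for g
    by (simp add: left_regular_def)
  show "finsum (module_mat TYPE(complex) n n) (left_regular G n en) A \<in> carrier_mat n n"
    by (rule finsum_module_mat(1)[OF finA lr])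
  assume ij: "i < n" "j < n"
  have c: "en i \<in> carrier G" "en j \<in> carrier G"
    using en ij bij_betwE by fast+
  have "finsum (module_mat TYPE(complex) n n) (left_regular G n en) A $$ (i, j) =
      (\<Sum>g\<in>A. if en i = g \<otimes> en j then 1 else 0)"
    using ij by (simp add: finsum_module_mat(2)[OF finA lr] left_regular_def)
  also have "\<dots> = (\<Sum>g\<in>A. if g = en i \<otimes> inv (en j) then 1 else 0)"
  proof (intro sum.cong refl if_cong)
    fix g assume "g \<in> A"
    then have "g \<in> carrier G" using A by blast
    then show "(en i = g \<otimes> en j) = (g = en i \<otimes> inv (en j))"
      using c inv_solve_right by metis
  qed
  finally show "finsum (module_mat TYPE(complex) n n) (left_regular G n en) A $$ (i, j) =
        of_bool (en i \<otimes> inv (en j) \<in> A)"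
    using finA by simp
qed

end

section \<open>Signature sets\<close>

theorem theorem3p6:
  fixes G :: "('a, 'b) monoid_scheme"
    and n :: nat
    and en :: "nat \<Rightarrow> 'a"
    and S T :: "'a set"
  assumes "group G" and "finite (carrier G)"
    and "Coset.order G = n" and "n \<ge> 2"
    and "bij_betw en {..<n} (carrier G)"
    and "S \<subseteq> carrier G - {\<one>\<^bsub>G\<^esub>}"
    and "T = (carrier G - {\<one>\<^bsub>G\<^esub>}) - S"
  shows "((\<exists>k. signature_set G en n k S) \<longleftrightarrow>
            ((\<forall>g\<in>S. inv\<^bsub>G\<^esub> g \<in> S) \<and> (\<forall>h\<in>T. inv\<^bsub>G\<^esub> h \<in> T)) \<and>
            (\<exists>\<mu>::real. balanced_products G S T \<mu>))
       \<and> (\<forall>k (\<mu>::real). signature_set G en n k S \<and> balanced_products G S T \<mu> \<longrightarrow>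
            \<mu> = (real n - 2 * real k)
                  * sqrt ((real n - 1) / (real k * (real n - real k))) \<and>
            real k = real n / 2
                  - \<mu> * real n / (2 * sqrt (4 * (real n - 1) + \<mu>\<^sup>2)))"
proof -
  note fin = assms(2) and n = assms(4) and en = assms(5) and S = assms(6) and T = assms(7)
  interpret group G by fact
  define q where "q = sign_coeff G S"
  define Q where "Q = finsum (module_mat TYPE(complex) n n) (left_regular G n en) S
        - finsum (module_mat TYPE(complex) n n) (left_regular G n en) (carrier G - {\<one>\<^bsub>G\<^esub>} - S)"
  have ST: "S \<subseteq> carrier G" "carrier G - {\<one>\<^bsub>G\<^esub>} - S \<subseteq> carrier G" using S by auto
  have Qc: "Q \<in> carrier_mat n n"
    unfolding Q_def using sum_left_regular_entry(1)[OF fin en] ST by (intro minus_carrier_mat)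
  have enc: "en i \<in> carrier G" if "i < n" for i
    using en that bij_betwE by fast
  have eninj: "en i = en j \<longleftrightarrow> i = j" if "i < n" "j < n" for i j
    using bij_betw_imp_inj_on[OF en] that unfolding inj_on_def by auto
  have Qq: "Q $$ (i, j) = complex_of_real (q (en i \<otimes>\<^bsub>G\<^esub> inv\<^bsub>G\<^esub> (en j)))" if "i < n" "j < n" for i j
  proof -
    have "Q $$ (i, j) = of_bool (en i \<otimes>\<^bsub>G\<^esub> inv\<^bsub>G\<^esub> (en j) \<in> S)
        - of_bool (en i \<otimes>\<^bsub>G\<^esub> inv\<^bsub>G\<^esub> (en j) \<in> carrier G - {\<one>\<^bsub>G\<^esub>} - S)"
      unfolding Q_def
      using that sum_left_regular_entry[OF fin en ST(1)] sum_left_regular_entry[OF fin en ST(2)]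
      by (subst index_minus_mat) auto
    also have "\<dots> = complex_of_real (q (en i \<otimes>\<^bsub>G\<^esub> inv\<^bsub>G\<^esub> (en j)))"
      using S enc that by (auto simp: q_def sign_coeff_def)
    finally show ?thesis .
  qed
  have quot1: "en i \<otimes>\<^bsub>G\<^esub> inv\<^bsub>G\<^esub> (en j) = \<one>\<^bsub>G\<^esub> \<longleftrightarrow> i = j" if "i < n" "j < n" for i j
    using enc that eninj[OF that] by (metis inv_solve_right' l_one one_closed)
  have quotinv: "inv\<^bsub>G\<^esub> (en i \<otimes>\<^bsub>G\<^esub> inv\<^bsub>G\<^esub> (en j)) = en j \<otimes>\<^bsub>G\<^esub> inv\<^bsub>G\<^esub> (en i)"
    if "i < n" "j < n" for i j
    using enc that by (simp add: inv_mult_group)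
  have quot: "\<exists>i<n. \<exists>j<n. g = en i \<otimes>\<^bsub>G\<^esub> inv\<^bsub>G\<^esub> (en j)" if "g \<in> carrier G" for g
  proof -
    have "g \<in> en ` {..<n}" "\<one>\<^bsub>G\<^esub> \<in> en ` {..<n}"
      using en that unfolding bij_betw_def by auto
    then obtain i j where ij: "i < n" "j < n" and eq: "g = en i" "en j = \<one>\<^bsub>G\<^esub>" by force
    have "g = en i \<otimes>\<^bsub>G\<^esub> inv\<^bsub>G\<^esub> (en j)" using that unfolding eq(2) by (simp add: eq(1))
    with ij show ?thesis by blast
  qed
  have diag: "Q $$ (i, i) = 0" if "i < n" for i
    using that quot1[of i i] by (simp add: Qq q_def sign_coeff_def)
  have uni: "cmod (Q $$ (i, j)) = 1" if "i < n" "j < n" "i \<noteq> j" for i j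
    using that quot1[of i j] by (simp add: Qq q_def sign_coeff_def)
  \<comment> \<open>Every group element is a quotient \<open>en i \<otimes> inv (en j)\<close>, so a condition on all entries of \<open>Q\<close> is
    a condition on all values of \<open>q\<close>.\<close>
  have herm: "mat_adjoint Q = Q \<longleftrightarrow>
      (\<forall>g\<in>S. inv\<^bsub>G\<^esub> g \<in> S) \<and> (\<forall>h\<in>T. inv\<^bsub>G\<^esub> h \<in> T)"
  proof -
    have "mat_adjoint Q = Q \<longleftrightarrow> (\<forall>g\<in>carrier G. q (inv\<^bsub>G\<^esub> g) = q g)"
    proof
      assume self: "mat_adjoint Q = Q"
      show "\<forall>g\<in>carrier G. q (inv\<^bsub>G\<^esub> g) = q g"
      proof
        fix g assume "g \<in> carrier G"
        then obtain i j where ij: "i < n" "j < n" and g: "g = en i \<otimes>\<^bsub>G\<^esub> inv\<^bsub>G\<^esub> (en j)"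
          using quot by blast
        have "Q $$ (j, i) = cnj (Q $$ (i, j))"
          using self ij unfolding mat_adjoint_eq_self_iff[OF Qc] by blast
        then show "q (inv\<^bsub>G\<^esub> g) = q g"
          unfolding g quotinv[OF ij] using ij by (simp add: Qq)
      qed
    next
      assume even: "\<forall>g\<in>carrier G. q (inv\<^bsub>G\<^esub> g) = q g"
      have "Q $$ (j, i) = cnj (Q $$ (i, j))" if ij: "i < n" "j < n" for i j
      proof -
        have "q (en j \<otimes>\<^bsub>G\<^esub> inv\<^bsub>G\<^esub> (en i)) = q (en i \<otimes>\<^bsub>G\<^esub> inv\<^bsub>G\<^esub> (en j))"
          unfolding quotinv[OF ij, symmetric] using even enc ij by blast
        then show ?thesis using ij by (simp add: Qq)
      qed
      then show "mat_adjoint Q = Q"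
        unfolding mat_adjoint_eq_self_iff[OF Qc] by blast
    qed
    also have "\<dots> \<longleftrightarrow> (\<forall>g\<in>S. inv\<^bsub>G\<^esub> g \<in> S) \<and> (\<forall>h\<in>T. inv\<^bsub>G\<^esub> h \<in> T)"
    proof -
      have "q (inv\<^bsub>G\<^esub> g) = q g \<longleftrightarrow> (inv\<^bsub>G\<^esub> g \<in> S \<longleftrightarrow> g \<in> S)" if "g \<in> carrier G" for g
        using S that by (auto simp: q_def sign_coeff_def)
      then have "(\<forall>g\<in>carrier G. q (inv\<^bsub>G\<^esub> g) = q g) \<longleftrightarrow>
          (\<forall>g\<in>carrier G. inv\<^bsub>G\<^esub> g \<in> S \<longleftrightarrow> g \<in> S)" by simp
      also have "\<dots> \<longleftrightarrow> (\<forall>g\<in>S. inv\<^bsub>G\<^esub> g \<in> S) \<and> (\<forall>h\<in>T. inv\<^bsub>G\<^esub> h \<in> T)"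
      proof
        assume inv: "\<forall>g\<in>carrier G. inv\<^bsub>G\<^esub> g \<in> S \<longleftrightarrow> g \<in> S"
        have "inv\<^bsub>G\<^esub> h \<in> T" if "h \<in> T" for h
          using that inv unfolding T by simp
        then show "(\<forall>g\<in>S. inv\<^bsub>G\<^esub> g \<in> S) \<and> (\<forall>h\<in>T. inv\<^bsub>G\<^esub> h \<in> T)"
          using inv ST(1) by blast
      next
        assume inv: "(\<forall>g\<in>S. inv\<^bsub>G\<^esub> g \<in> S) \<and> (\<forall>h\<in>T. inv\<^bsub>G\<^esub> h \<in> T)"
        show "\<forall>g\<in>carrier G. inv\<^bsub>G\<^esub> g \<in> S \<longleftrightarrow> g \<in> S"
        proof
          fix g assume g: "g \<in> carrier G"
          have "g \<in> S" if "inv\<^bsub>G\<^esub> g \<in> S"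
            using inv that inv_inv[OF g] by metis
          with inv show "inv\<^bsub>G\<^esub> g \<in> S \<longleftrightarrow> g \<in> S" by blast
        qed
      qed
      finally show ?thesis .
    qed
    finally show ?thesis .
  qed
  have square: "(\<Sum>l<n. Q $$ (i, l) * Q $$ (l, j)) =
      complex_of_real (signed_product_count G S T (en i \<otimes>\<^bsub>G\<^esub> inv\<^bsub>G\<^esub> (en j)))"
    if ij: "i < n" "j < n" for i j
  proof -
    have "(\<Sum>l<n. Q $$ (i, l) * Q $$ (l, j)) = complex_of_real
        (\<Sum>l<n. q (en i \<otimes>\<^bsub>G\<^esub> inv\<^bsub>G\<^esub> (en l)) * q (en l \<otimes>\<^bsub>G\<^esub> inv\<^bsub>G\<^esub> (en j)))"
      using ij by (simp add: Qq)
    also have "(\<Sum>l<n. q (en i \<otimes>\<^bsub>G\<^esub> inv\<^bsub>G\<^esub> (en l)) * q (en l \<otimes>\<^bsub>G\<^esub> inv\<^bsub>G\<^esub> (en j))) =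
        signed_product_count G S T (en i \<otimes>\<^bsub>G\<^esub> inv\<^bsub>G\<^esub> (en j))"
      unfolding sum_translates_eq_convolution[OF en enc[OF ij(1)] enc[OF ij(2)]] q_def
      by (rule sign_coeff_convolution[OF fin S T]) (use enc ij in simp)
    finally show ?thesis .
  qed
  have balanced: "balanced_products G S T \<mu> \<longleftrightarrow> (\<forall>i<n. \<forall>j<n. i \<noteq> j \<longrightarrow>
      (\<Sum>l<n. Q $$ (i, l) * Q $$ (l, j)) = complex_of_real \<mu> * Q $$ (i, j))" for \<mu>
  proof -
    have "balanced_products G S T \<mu> \<longleftrightarrow>
        (\<forall>g\<in>carrier G - {\<one>\<^bsub>G\<^esub>}. signed_product_count G S T g = \<mu> * q g)"
      using S by (auto simp: balanced_products_def signed_product_count_def q_def sign_coeff_def T)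
    also have "\<dots> \<longleftrightarrow> (\<forall>i<n. \<forall>j<n. i \<noteq> j \<longrightarrow>
        signed_product_count G S T (en i \<otimes>\<^bsub>G\<^esub> inv\<^bsub>G\<^esub> (en j)) = \<mu> * q (en i \<otimes>\<^bsub>G\<^esub> inv\<^bsub>G\<^esub> (en j)))"
      (is "?L \<longleftrightarrow> ?R")
    proof
      assume ?L then show ?R using quot1 enc by simp
    next
      assume R: ?R
      show ?L
      proof
        fix g assume g: "g \<in> carrier G - {\<one>\<^bsub>G\<^esub>}"
        then obtain i j where ij: "i < n" "j < n" "g = en i \<otimes>\<^bsub>G\<^esub> inv\<^bsub>G\<^esub> (en j)"
          using quot by blast
        with g quot1 have "i \<noteq> j" by blast
        with R ij show "signed_product_count G S T g = \<mu> * q g" by blast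
      qed
    qed
    also have "\<dots> \<longleftrightarrow> (\<forall>i<n. \<forall>j<n. i \<noteq> j \<longrightarrow>
      (\<Sum>l<n. Q $$ (i, l) * Q $$ (l, j)) = complex_of_real \<mu> * Q $$ (i, j))"
    proof -
      have "(\<Sum>l<n. Q $$ (i, l) * Q $$ (l, j)) = complex_of_real \<mu> * Q $$ (i, j) \<longleftrightarrow>
        signed_product_count G S T (en i \<otimes>\<^bsub>G\<^esub> inv\<^bsub>G\<^esub> (en j)) = \<mu> * q (en i \<otimes>\<^bsub>G\<^esub> inv\<^bsub>G\<^esub> (en j))"
        if "i < n" "j < n" for i j
        unfolding square[OF that] Qq[OF that] of_real_mult[symmetric] of_real_eq_iff ..
      then show ?thesis by blast
    qed
    finally show ?thesis .
  qed
  have sigset: "signature_set G en n k S \<longleftrightarrow> signature_matrix n k Q" for k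
    unfolding signature_set_def Q_def using S by simp
  have mu: "balanced_products G S T (signature_mu n k)" if "signature_set G en n k S" for k
    using that signature_matrix_square unfolding sigset balanced by blast
  show ?thesis
  proof (intro conjI iffI allI impI)
    assume "\<exists>k. signature_set G en n k S"
    then obtain k where k: "signature_set G en n k S" by blast
    then have "mat_adjoint Q = Q"
      unfolding sigset signature_matrix_def by blast
    then show "\<forall>g\<in>S. inv\<^bsub>G\<^esub> g \<in> S" "\<forall>h\<in>T. inv\<^bsub>G\<^esub> h \<in> T"
      using herm by blast+
    show "\<exists>\<mu>. balanced_products G S T \<mu>" using mu[OF k] by blast
  next
    assume ab: "((\<forall>g\<in>S. inv\<^bsub>G\<^esub> g \<in> S) \<and> (\<forall>h\<in>T. inv\<^bsub>G\<^esub> h \<in> T)) \<and>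
      (\<exists>\<mu>. balanced_products G S T \<mu>)"
    then obtain \<mu> where "balanced_products G S T \<mu>" by blast
    with ab show "\<exists>k. signature_set G en n k S"
      unfolding sigset balanced herm[symmetric]
      using signature_matrix_of_square[OF n Qc _ diag uni, of \<mu>] by blast
  next
    fix k \<mu>
    assume asm: "signature_set G en n k S \<and> balanced_products G S T \<mu>"
    \<comment> \<open>As \<open>n \<ge> 2\<close>, the matrix \<open>Q\<close> has a nonzero entry off the diagonal, which pins down \<open>\<mu>\<close>.\<close>
    have "0 < n" "1 < n" using n by auto
    have "Q $$ (0, 1) \<noteq> 0"
      using uni[OF \<open>0 < n\<close> \<open>1 < n\<close>] by auto
    moreover have "(\<Sum>l<n. Q $$ (0, l) * Q $$ (l, 1)) = complex_of_real \<nu> * Q $$ (0, 1)"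
      if "balanced_products G S T \<nu>" for \<nu>
      by (rule balanced[THEN iffD1, OF that, rule_format]) (use n in auto)
    note this[OF conjunct2[OF asm]] this[OF mu[OF conjunct1[OF asm]]]
    ultimately have eq: "\<mu> = signature_mu n k" by simp
    show "\<mu> = (real n - 2 * real k) * sqrt ((real n - 1) / (real k * (real n - real k)))"
      unfolding eq by (rule signature_mu_def)
    show "real k = real n / 2 - \<mu> * real n / (2 * sqrt (4 * (real n - 1) + \<mu>\<^sup>2))"
      using asm eq by (intro signature_mu_determines_rank)
        (auto simp: sigset signature_matrix_def)
  qed
qed

end
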